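(* Let $x\in\mathbb{R}^d$. There exists a minimizer $\bar w$ of the reparametrized problem $$\inf\left\{\frac12\int_0^\infty e^{-\lambda t}\|y(t)-y_d\|_2^2\,dt+\gamma\sum_{k=0}^\infty\Big(\sum_{i=1}^m|w_{i,k}|\Big)^{q/p}\ :\ w\in\ell^{q/p}(\ell^1),\ (\Phi(w))_{\cdot,k}\in U\ \text{for all }k\ge 0\right\},$$ where $y$ solves $$\dot y(t)=f_0(y(t))+\sum_{i=1}^m f_i(y(t))\,b_k^{-1/q}|w_{i,k}|^{1/p}\operatorname{sgn}(w_{i,k})\quad\text{for }t\in[t_k,t_{k+1}),\ k=0,1,\dots,\qquad y(0)=x,$$ and hence there exists a minimizer $\bar u\in U^\Delta$ of the time-discretized problem $$\inf_{u\in U^\Delta}J^\Delta(x,u),\qquad J^\Delta(x,u)=\int_0^\infty e^{-\lambda t}\left(\frac12\|y(t)-y_d\|_2^2+\gamma\Big(\sum_{i=1}^m\sum_{k=0}^\infty|u_{i,k}|^p\mathbf{1}_{I_k}(t)\Big)^{q/p}\right)dt,$$ where $y$ solves $\dot y(t)=f_0(y(t))+\sum_{i=1}^m f_i(y(t))u_i(t)$ on $(0,\infty)$, $y(0)=x$.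
   Context: Parameters: $0<p<1$, $q\in[p,1]$, $\lambda>0$, $\gamma>0$, $y_d\in\mathbb{R}^d$. The maps $f_i:\mathbb{R}^d\to\mathbb{R}^d$, $i=0,\dots,m$, are continuously differentiable. Standing assumptions: the control set $U\subset\mathbb{R}^m$ is compact and convex; there exists $L>0$ such that $\|f_i(x_1)-f_i(x_2)\|_2\le L\|x_1-x_2\|_2$ for all $x_1,x_2\in\mathbb{R}^d$ and $i=0,\dots,m$; for each $x\in\mathbb{R}^d$ there exists $u\in L^\infty(0,\infty;U)$ with $J(x,u)<\infty$, where $J(x,u)=\int_0^\infty e^{-\lambda t}\big(\frac12\|y(t)-y_d\|_2^2+\gamma\|u(t)\|_p^q\big)dt$, $\|u\|_p=(\sum_{i=1}^m|u_i|^p)^{1/p}$, and $y$ is the solution of $\dot y=f_0(y)+\sum_i f_i(y)u_i$, $y(0)=x$. Temporal grid: $0=t_0<t_1<\cdots<t_k<t_{k+1}<\cdots$ with $t_k\to\infty$, $I_k=[t_k,t_{k+1})$, and $b_k=\int_{I_k}e^{-\lambda t}dt=\frac1\lambda(e^{-\lambda t_k}-e^{-\lambda t_{k+1}})$. $U^\Delta$ is the set of $u=(u_1,\dots,u_m)\in L^\infty(0,\infty;U)$ that are constant on each $I_k$, with $u_i(t)=u_{i,k}$ for $t\in I_k$, $i=1,\dots,m$, $k\ge0$. Sequence spaces: $\ell^{q/p}(\ell^1)$ is the space of $\mathbb{R}^m$-valued sequences $w=(w_{i,k})$ with $\sum_{k=0}^\infty(\sum_{i=1}^m|w_{i,k}|)^{q/p}<\infty$.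 The map $\Phi$ is given by $(\Phi(w))_{i,k}=b_k^{-1/q}|w_{i,k}|^{1/p}\operatorname{sgn}(w_{i,k})$; the controls in the two problems are related by $u_{i,k}=(\Phi(w))_{i,k}$. *)

theory Defs
  imports "HOL-Analysis.Analysis" "HOL-Library.FuncSet"
begin

definition continuously_differentiable ::
  "('a::real_normed_vector \<Rightarrow> 'b::real_normed_vector) \<Rightarrow> bool" where
  "continuously_differentiable g \<longleftrightarrow>
     (\<exists>g' :: 'a \<Rightarrow> ('a \<Rightarrow>\<^sub>L 'b).
        (\<forall>x. (g has_derivative blinfun_apply (g' x)) (at x)) \<and> continuous_on UNIV g')"

definition control_field ::
  "(real^'d \<Rightarrow> real^'d) \<Rightarrow> ('m::finite \<Rightarrow> real^'d \<Rightarrow> real^'d) \<Rightarrow> real^'m \<Rightarrow> real^'d \<Rightarrow> real^'d" where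
  "control_field f0 f v z = f0 z + (\<Sum>i\<in>UNIV. (v $ i) *\<^sub>R f i z)"

definition p_norm :: "real \<Rightarrow> real^'m \<Rightarrow> real" where
  "p_norm p v = (\<Sum>i\<in>UNIV. \<bar>v $ i\<bar> powr p) powr (1 / p)"

text \<open>The elements of \<open>L\<^sup>\<infinity>(0,\<infinity>;U)\<close>, as functions rather than classes; the values off
  \<open>(0,\<infinity>)\<close> are irrelevant.\<close>
definition Linf_controls :: "(real^'m) set \<Rightarrow> (real \<Rightarrow> real^'m) set" where
  "Linf_controls U = {u. set_borel_measurable lebesgue {0<..} u \<and>
     (\<exists>C. AE t in lebesgue. 0 < t \<longrightarrow> norm (u t) \<le> C) \<and>
     (AE t in lebesgue. 0 < t \<longrightarrow> u t \<in> U)}"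

text \<open>For merely measurable controls the state equation is understood in the sense of
  Caratheodory, that is, in its integrated form.\<close>
definition solves_state_equation ::
  "(real^'d \<Rightarrow> real^'d) \<Rightarrow> ('m::finite \<Rightarrow> real^'d \<Rightarrow> real^'d) \<Rightarrow> real^'d \<Rightarrow> (real \<Rightarrow> real^'m) \<Rightarrow>
   (real \<Rightarrow> real^'d) \<Rightarrow> bool" where
  "solves_state_equation f0 f x u y \<longleftrightarrow> continuous_on {0..} y \<and>
     (\<forall>T\<ge>0. (\<lambda>s. control_field f0 f (u s) (y s)) absolutely_integrable_on {0..T} \<and>
            y T = x + integral {0..T} (\<lambda>s. control_field f0 f (u s) (y s)))"

text \<open>Solutions live on \<open>[0,\<infinity>)\<close>. Extensionality fixes their values at negative times, so that
  the (globally existing and unique) solution can be named by a definite description.\<close>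
definition state ::
  "(real^'d \<Rightarrow> real^'d) \<Rightarrow> ('m::finite \<Rightarrow> real^'d \<Rightarrow> real^'d) \<Rightarrow> real^'d \<Rightarrow> (real \<Rightarrow> real^'m) \<Rightarrow>
   real \<Rightarrow> real^'d" where
  "state f0 f x u = (THE y. y \<in> extensional {0..} \<and> solves_state_equation f0 f x u y)"

text \<open>Costs are valued in \<open>[0,\<infinity>]\<close>.\<close>
definition cost ::
  "real \<Rightarrow> real \<Rightarrow> real \<Rightarrow> real \<Rightarrow> real^'d \<Rightarrow> (real^'d \<Rightarrow> real^'d) \<Rightarrow>
   ('m::finite \<Rightarrow> real^'d \<Rightarrow> real^'d) \<Rightarrow> real^'d \<Rightarrow> (real \<Rightarrow> real^'m) \<Rightarrow> ennreal" where
  "cost p q lam gam yd f0 f x u =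
     (\<integral>\<^sup>+t\<in>{0..}. ennreal (exp (- lam * t) *
        (1/2 * (norm (state f0 f x u t - yd))\<^sup>2 + gam * p_norm p (u t) powr q)) \<partial>lebesgue)"

definition temporal_grid :: "(nat \<Rightarrow> real) \<Rightarrow> bool" where
  "temporal_grid \<tau> \<longleftrightarrow> \<tau> 0 = 0 \<and> strict_mono \<tau> \<and> filterlim \<tau> at_top sequentially"

definition grid_interval :: "(nat \<Rightarrow> real) \<Rightarrow> nat \<Rightarrow> real set" where
  "grid_interval \<tau> k = {\<tau> k..<\<tau> (Suc k)}"

definition grid_weight :: "real \<Rightarrow> (nat \<Rightarrow> real) \<Rightarrow> nat \<Rightarrow> real" where
  "grid_weight lam \<tau> k = integral (grid_interval \<tau> k) (\<lambda>t. exp (- lam * t))"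

lemma grid_weight_eq:
  assumes "lam > 0" "strict_mono \<tau>"
  shows "grid_weight lam \<tau> k = (exp (- lam * \<tau> k) - exp (- lam * \<tau> (Suc k))) / lam"
proof -
  have "\<tau> k \<le> \<tau> (Suc k)"
    using assms(2) by (simp add: strict_mono_less_eq)
  then have "((\<lambda>t. exp (- lam * t)) has_integral
      (- exp (- lam * \<tau> (Suc k)) / lam - (- exp (- lam * \<tau> k) / lam))) {\<tau> k..\<tau> (Suc k)}"
    using assms(1)
    by (intro fundamental_theorem_of_calculus)
       (auto intro!: derivative_eq_intros simp flip: has_real_derivative_iff_has_vector_derivative)
  then have "integral {\<tau> k..\<tau> (Suc k)} (\<lambda>t. exp (- lam * t)) =
      (exp (- lam * \<tau> k) - exp (- lam * \<tau> (Suc k))) / lam"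
    by (auto dest!: integral_unique simp: diff_divide_distrib)
  moreover have "integral (grid_interval \<tau> k) (\<lambda>t. exp (- lam * t)) =
      integral {\<tau> k..\<tau> (Suc k)} (\<lambda>t. exp (- lam * t))"
    unfolding grid_interval_def
    by (rule integral_subset_negligible)
       (auto intro!: negligible_subset[OF negligible_sing[of "\<tau> (Suc k)"]])
  ultimately show ?thesis
    by (simp add: grid_weight_def)
qed

definition discrete_controls :: "(nat \<Rightarrow> real) \<Rightarrow> (real^'m) set \<Rightarrow> (real \<Rightarrow> real^'m) set" where
  "discrete_controls \<tau> U = {u \<in> Linf_controls U. \<forall>k. u constant_on grid_interval \<tau> k}"

text \<open>For a control that is constant on the grid intervals, \<open>u\<^sub>i\<^sub>,\<^sub>k\<close> is its \<open>i\<close>-th component at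
  the left end point of the \<open>k\<close>-th interval.\<close>
definition discrete_cost ::
  "real \<Rightarrow> real \<Rightarrow> real \<Rightarrow> real \<Rightarrow> real^'d \<Rightarrow> (nat \<Rightarrow> real) \<Rightarrow> (real^'d \<Rightarrow> real^'d) \<Rightarrow>
   ('m::finite \<Rightarrow> real^'d \<Rightarrow> real^'d) \<Rightarrow> real^'d \<Rightarrow> (real \<Rightarrow> real^'m) \<Rightarrow> ennreal" where
  "discrete_cost p q lam gam yd \<tau> f0 f x u =
     (\<integral>\<^sup>+t\<in>{0..}. ennreal (exp (- lam * t) *
        (1/2 * (norm (state f0 f x u t - yd))\<^sup>2 +
         gam * (\<Sum>i\<in>UNIV. \<Sum>k. \<bar>u (\<tau> k) $ i\<bar> powr p * indicator (grid_interval \<tau> k) t) powr (q / p)))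
        \<partial>lebesgue)"

definition weight_space :: "real \<Rightarrow> real \<Rightarrow> (nat \<Rightarrow> real^'m) set" where
  "weight_space p q = {w. summable (\<lambda>k. (\<Sum>i\<in>UNIV. \<bar>w k $ i\<bar>) powr (q / p))}"

definition reparam ::
  "real \<Rightarrow> real \<Rightarrow> real \<Rightarrow> (nat \<Rightarrow> real) \<Rightarrow> (nat \<Rightarrow> real^'m) \<Rightarrow> nat \<Rightarrow> real^'m" where
  "reparam p q lam \<tau> w k =
     (\<chi> i. grid_weight lam \<tau> k powr (- 1 / q) * \<bar>w k $ i\<bar> powr (1 / p) * sgn (w k $ i))"

text \<open>At the left end point of a grid interval the derivative is one-sided, since it is taken
  within the interval.\<close>
definition solves_grid_equation ::
  "(nat \<Rightarrow> real) \<Rightarrow> (real^'d \<Rightarrow> real^'d) \<Rightarrow> ('m::finite \<Rightarrow> real^'d \<Rightarrow> real^'d) \<Rightarrow> real^'d \<Rightarrow>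
   (nat \<Rightarrow> real^'m) \<Rightarrow> (real \<Rightarrow> real^'d) \<Rightarrow> bool" where
  "solves_grid_equation \<tau> f0 f x v y \<longleftrightarrow> continuous_on {0..} y \<and> y 0 = x \<and>
     (\<forall>k. \<forall>t\<in>grid_interval \<tau> k.
        (y has_vector_derivative control_field f0 f (v k) (y t)) (at t within grid_interval \<tau> k))"

definition grid_state ::
  "(nat \<Rightarrow> real) \<Rightarrow> (real^'d \<Rightarrow> real^'d) \<Rightarrow> ('m::finite \<Rightarrow> real^'d \<Rightarrow> real^'d) \<Rightarrow> real^'d \<Rightarrow>
   (nat \<Rightarrow> real^'m) \<Rightarrow> real \<Rightarrow> real^'d" where
  "grid_state \<tau> f0 f x v = (THE y. y \<in> extensional {0..} \<and> solves_grid_equation \<tau> f0 f x v y)"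

definition reparam_feasible ::
  "real \<Rightarrow> real \<Rightarrow> real \<Rightarrow> (nat \<Rightarrow> real) \<Rightarrow> (real^'m) set \<Rightarrow> (nat \<Rightarrow> real^'m) set" where
  "reparam_feasible p q lam \<tau> U = {w \<in> weight_space p q. \<forall>k. reparam p q lam \<tau> w k \<in> U}"

definition reparam_cost ::
  "real \<Rightarrow> real \<Rightarrow> real \<Rightarrow> real \<Rightarrow> real^'d \<Rightarrow> (nat \<Rightarrow> real) \<Rightarrow> (real^'d \<Rightarrow> real^'d) \<Rightarrow>
   ('m::finite \<Rightarrow> real^'d \<Rightarrow> real^'d) \<Rightarrow> real^'d \<Rightarrow> (nat \<Rightarrow> real^'m) \<Rightarrow> ennreal" where
  "reparam_cost p q lam gam yd \<tau> f0 f x w =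
     ennreal (1/2) * (\<integral>\<^sup>+t\<in>{0..}. ennreal (exp (- lam * t) *
        (norm (grid_state \<tau> f0 f x (reparam p q lam \<tau> w) t - yd))\<^sup>2) \<partial>lebesgue) +
     ennreal (gam * (\<Sum>k. (\<Sum>i\<in>UNIV. \<bar>w k $ i\<bar>) powr (q / p)))"

end

theory Submission imports Defs begin

text \<open>The map \<open>w \<mapsto> \<Phi>(w)\<close> is a bijection from the feasible sequences onto
  \<open>U\<^sup>\<nat>\<close> (summability is automatic because \<open>U\<close> is bounded and \<open>\<Sum>\<^sub>k b\<^sub>k < \<infinity>\<close>), and it carries
  the reparametrized cost into \<open>J\<^sup>\<Delta>\<close>, so both problems amount to minimizing \<open>J\<^sup>\<Delta>\<close> over
  \<open>U\<^sup>\<nat>\<close>. This set is compact in the product topology. By Gronwall's inequality and dominated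
  convergence the state at each time depends continuously on the sequence of control values, so
  Fatou's lemma makes \<open>J\<^sup>\<Delta>\<close> lower semicontinuous.\<close>

section \<open>Integral equations with a Lipschitz right-hand side\<close>

text \<open>Two obstacles shape the argument. For \<open>p < 1\<close> the control cost need not be
  convex, so weak convergence of controls would not give lower semicontinuity; on a fixed grid,
  however, a control is a sequence of vectors, and coordinatewise convergence passes through any
  continuous cost. Secondly, states may grow faster than \<open>exp (lam * t / 2)\<close>, so the
  tracking terms have no common integrable bound on the half line and a cost may be infinite.
  Dominated convergence therefore serves only for the fields on compact time intervals, where common
  Lipschitz and growth constants exist, while the cost itself takes values in \<open>ennreal\<close>
  and is handled by Fatou. The state is specified in two ways, by an integral equation and by
  differential equations on the grid intervals. Both are reduced to the single notion
  \<open>integral_solution\<close>, for which existence, uniqueness and stability are proved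
  once.\<close>

lemma gronwall_integral:
  fixes d :: "real \<Rightarrow> real"
  assumes cont: "continuous_on {0..T} d" and "0 \<le> T" "0 \<le> M"
    and le: "\<And>t. t \<in> {0..T} \<Longrightarrow> d t \<le> c + M * integral {0..t} d"
  shows "d T \<le> c * exp (M * T)"
proof -
  \<comment> \<open>Integrating factor: the derivative of \<open>h\<close> is a nonnegative multiple
    of \<open>d t - (c + M * integral {0..t} d)\<close>, so the assumed inequality says that
    \<open>h\<close> does not increase, and \<open>h 0 = c\<close>.\<close>
  define h where "h t = exp (- M * t) * (c + M * integral {0..t} d)" for t
  have "h T \<le> h 0"
  proof (rule DERIV_nonpos_imp_decreasing_open[OF \<open>0 \<le> T\<close>])
    fix t assume t: "0 < t" "t < T"
    have "((\<lambda>u. integral {0..u} d) has_real_derivative d t) (at t within {0..T})"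
      by (rule integral_has_real_derivative[OF cont]) (use t in auto)
    then have "((\<lambda>u. integral {0..u} d) has_real_derivative d t) (at t)"
      using t by (simp add: at_within_Icc_at)
    then have "(h has_real_derivative exp (- M * t) * M * (d t - (c + M * integral {0..t} d))) (at t)"
      unfolding h_def
      by (auto intro!: derivative_eq_intros simp: algebra_simps)
    moreover have "exp (- M * t) * M * (d t - (c + M * integral {0..t} d)) \<le> 0"
      using le[of t] t \<open>0 \<le> M\<close> by (intro mult_nonneg_nonpos) auto
    ultimately show "\<exists>y. (h has_real_derivative y) (at t) \<and> y \<le> 0"
      by blast
  next
    show "continuous_on {0..T} h"
      unfolding h_def
      by (intro continuous_intros indefinite_integral_continuous_1
          integrable_continuous_real cont)
  qed
  then have "exp (- M * T) * (c + M * integral {0..T} d) \<le> c"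
    by (simp add: h_def)
  then have "c + M * integral {0..T} d \<le> c * exp (M * T)"
    by (simp add: exp_minus field_simps)
  with le[of T] \<open>0 \<le> T\<close> show ?thesis
    by simp
qed

lemma continuous_on_half_line:
  fixes y :: "real \<Rightarrow> 'a::topological_space"
  assumes "\<And>T. 0 \<le> T \<Longrightarrow> continuous_on {0..T} y"
  shows "continuous_on {0..} y"
  unfolding continuous_on_eq_continuous_within
proof
  fix t :: real assume "t \<in> {0..}"
  \<comment> \<open>The end point is \<open>t + 1\<close> because the interval must contain a right
    neighbourhood of \<open>t\<close>; with end point \<open>t\<close> only left continuity would
    result.\<close>
  then have "continuous (at t within {0..t + 1}) y"
    using assms[of "t + 1"] by (simp add: continuous_on_eq_continuous_within)
  moreover have "at t within {0..t + 1} = at t within {0..}"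
    by (rule at_within_nhd[of _ "{t - 1<..<t + 1}"]) auto
  ultimately show "continuous (at t within {0..}) y"
    by simp
qed

text \<open>The notion of \<open>solves_state_equation\<close> for an arbitrary time-dependent
  field, so that the theory below is free of controls.\<close>

definition integral_solution ::
  "(real \<Rightarrow> 'a \<Rightarrow> 'a) \<Rightarrow> 'a::euclidean_space \<Rightarrow> (real \<Rightarrow> 'a) \<Rightarrow> bool" where
  "integral_solution F x y \<longleftrightarrow> continuous_on {0..} y \<and>
     (\<forall>T\<ge>0. (\<lambda>s. F s (y s)) absolutely_integrable_on {0..T} \<and>
            y T = x + integral {0..T} (\<lambda>s. F s (y s)))"

lemma integral_solution_cong:
  assumes y: "\<And>s. 0 \<le> s \<Longrightarrow> y s = z s" and F: "\<And>s. 0 \<le> s \<Longrightarrow> F s (z s) = G s (z s)"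
  shows "integral_solution F x y \<longleftrightarrow> integral_solution G x z"
proof -
  have "continuous_on {0..} y \<longleftrightarrow> continuous_on {0..} z"
    by (rule continuous_on_cong) (use y in auto)
  moreover have "(\<lambda>s. F s (y s)) absolutely_integrable_on {0..T} \<longleftrightarrow>
      (\<lambda>s. G s (z s)) absolutely_integrable_on {0..T}" for T
    unfolding absolutely_integrable_on_def using y F
    by (intro conj_cong integrable_cong) auto
  moreover have "integral {0..T} (\<lambda>s. F s (y s)) = integral {0..T} (\<lambda>s. G s (z s))" for T
    by (rule integral_cong) (use y F in auto)
  ultimately show ?thesis
    using y by (simp add: integral_solution_def)
qed

text \<open>Measurability in time is required only along continuous curves, the form in which the
  integral equation uses it. \<open>K\<close> bounds the field at the origin and so, with
  \<open>M\<close>, gives linear growth; \<open>M\<close> is positive because the weighted estimates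
  divide by \<open>2 * M\<close>.\<close>

locale lipschitz_field =
  fixes F :: "real \<Rightarrow> 'a::euclidean_space \<Rightarrow> 'a" and M K :: real
  assumes M_pos: "0 < M"
    and lipschitz: "0 \<le> t \<Longrightarrow> norm (F t a - F t b) \<le> M * norm (a - b)"
    and bound_zero: "0 \<le> t \<Longrightarrow> norm (F t 0) \<le> K"
    and measurable_comp:
      "continuous_on {0..} y \<Longrightarrow> (\<lambda>s. F s (y s)) \<in> borel_measurable (lebesgue_on {0..})"
begin

lemma growth: "0 \<le> t \<Longrightarrow> norm (F t a) \<le> K + M * norm a"
  using lipschitz[of t a 0] bound_zero[of t] norm_triangle_sub[of "F t a" "F t 0"] by simp

lemma K_nonneg: "0 \<le> K"
  using bound_zero[of 0] norm_ge_zero[of "F 0 0"] by linarith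

lemma absolutely_integrable_comp:
  assumes y: "continuous_on {0..} y" and "0 \<le> T"
  shows "(\<lambda>s. F s (y s)) absolutely_integrable_on {0..T}"
proof (rule measurable_bounded_by_integrable_imp_absolutely_integrable)
  show "(\<lambda>s. F s (y s)) \<in> borel_measurable (lebesgue_on {0..T})"
    by (rule measurable_restrict_mono[OF measurable_comp[OF y]]) auto
  show "(\<lambda>s. K + M * norm (y s)) integrable_on {0..T}"
    by (intro integrable_continuous_real continuous_intros continuous_on_subset[OF y]) auto
qed (use growth in auto)

lemma integrable_comp:
  assumes "continuous_on {0..} y" "0 \<le> T"
  shows "(\<lambda>s. F s (y s)) integrable_on {0..T}"
  using absolutely_integrable_comp[OF assms] by (simp add: absolutely_integrable_on_def)

lemma integral_solution_iff:
  "integral_solution F x y \<longleftrightarrow>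
     continuous_on {0..} y \<and> (\<forall>T\<ge>0. y T = x + integral {0..T} (\<lambda>s. F s (y s)))"
  using absolutely_integrable_comp unfolding integral_solution_def by blast

text \<open>In the norm \<open>sup\<^sub>t e\<^sup>-\<^sup>2\<^sup>M\<^sup>t |y t|\<close> the Picard operator is a contraction
  on the whole half line at once. The operator below is conjugated by the weight, and extended
  constantly to negative times so that it acts on bounded continuous functions on the real line.\<close>
lemma integral_solution_exists: "\<exists>y. integral_solution F x y"
proof -
  define Y where "Y g s = exp (2 * M * s) *\<^sub>R apply_bcontfun g s" for g :: "real \<Rightarrow>\<^sub>C 'a" and s
  define P where "P g t = exp (- (2 * M * t)) *\<^sub>R (x + integral {0..t} (\<lambda>s. F s (Y g s)))" for g t
  have contY: "continuous_on S (Y g)" for g S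
    unfolding Y_def by (intro continuous_intros continuous_on_apply_bcontfun)
  have int: "(\<lambda>s. F s (Y g s)) integrable_on {0..T}" if "0 \<le> T" for g T
    by (rule integrable_comp[OF contY that])
  have exp_int: "((\<lambda>s. B * exp (2 * M * s)) has_integral B * ((exp (2 * M * t) - 1) / (2 * M))) {0..t}"
    if "0 \<le> t" for t B :: real
  proof -
    have "((\<lambda>s. exp (2 * M * s)) has_integral
        (exp (2 * M * t) / (2 * M) - exp (2 * M * 0) / (2 * M))) {0..t}"
      by (rule fundamental_theorem_of_calculus[OF that])
         (use M_pos in \<open>auto intro!: derivative_eq_intros
            simp flip: has_real_derivative_iff_has_vector_derivative\<close>)
    then show ?thesis
      by (intro has_integral_mult_right) (simp add: diff_divide_distrib)
  qed
  have exp_integrable: "(\<lambda>s. B * exp (2 * M * s)) integrable_on {0..t}" if "0 \<le> t" for t B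
    using exp_int[OF that] by blast
  \<comment> \<open>This explains the rate \<open>2 * M\<close> of the weight: an integrand bounded
    by \<open>B * exp (2 * M * s)\<close> contributes at most \<open>B / (2 * M)\<close> after
    reweighting, uniformly in \<open>t\<close>. With \<open>B = M * dist g h\<close> the contraction
    factor is \<open>1 / 2\<close>.\<close>
  have decay: "exp (- (2 * M * t)) * (B * ((exp (2 * M * t) - 1) / (2 * M))) \<le> B / (2 * M)"
    if "0 \<le> t" "0 \<le> B" for t B
  proof -
    have "exp (- (2 * M * t)) * (B * ((exp (2 * M * t) - 1) / (2 * M))) =
        B / (2 * M) * (1 - exp (- (2 * M * t)))"
      using M_pos by (simp add: field_simps exp_minus)
    also have "\<dots> \<le> B / (2 * M) * 1"
      using that M_pos by (intro mult_left_mono) auto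
    finally show ?thesis by simp
  qed
  have contP: "continuous_on {0..} (P g)" for g
    unfolding P_def
    by (intro continuous_intros continuous_on_half_line indefinite_integral_continuous_1 int)
  have boundP: "norm (P g t) \<le> norm x + (K + M * norm g) / (2 * M)" if "0 \<le> t" for g t
  proof -
    have "norm (integral {0..t} (\<lambda>s. F s (Y g s))) \<le>
        integral {0..t} (\<lambda>s. (K + M * norm g) * exp (2 * M * s))"
    proof (rule integral_norm_bound_integral)
      fix s assume s: "s \<in> {0..t}"
      have "norm (F s (Y g s)) \<le> K + M * (exp (2 * M * s) * norm (apply_bcontfun g s))"
        using growth[of s "Y g s"] s by (simp add: Y_def)
      \<comment> \<open>As \<open>s\<close> is nonnegative, \<open>exp (2 * M * s)\<close> is at
        least 1, so the constant \<open>K\<close> can be absorbed into the weight.\<close>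
      also have "\<dots> \<le> K * exp (2 * M * s) + M * (exp (2 * M * s) * norm g)"
        using s M_pos K_nonneg
        by (intro add_mono mult_left_mono norm_bounded) (auto simp: mult_le_cancel_left1)
      finally show "norm (F s (Y g s)) \<le> (K + M * norm g) * exp (2 * M * s)"
        by (simp add: algebra_simps)
    qed (rule int exp_integrable that)+
    also have "\<dots> = (K + M * norm g) * ((exp (2 * M * t) - 1) / (2 * M))"
      by (rule integral_unique[OF exp_int[OF that]])
    finally have I: "norm (integral {0..t} (\<lambda>s. F s (Y g s))) \<le> \<dots>" .
    have "norm (P g t) \<le> exp (- (2 * M * t)) * (norm x + norm (integral {0..t} (\<lambda>s. F s (Y g s))))"
      by (simp add: P_def norm_triangle_ineq)
    also have "\<dots> \<le> exp (- (2 * M * t)) *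
        (norm x + (K + M * norm g) * ((exp (2 * M * t) - 1) / (2 * M)))"
      using I by simp
    also have "\<dots> \<le> 1 * norm x + (K + M * norm g) / (2 * M)"
      unfolding distrib_left
      using that M_pos K_nonneg by (intro add_mono decay mult_right_mono) auto
    finally show ?thesis by simp
  qed
  have dist_P: "dist (P g t) (P h t) \<le> 1 / 2 * dist g h" if "0 \<le> t" for g h t
  proof -
    have "norm (integral {0..t} (\<lambda>s. F s (Y g s)) - integral {0..t} (\<lambda>s. F s (Y h s))) =
        norm (integral {0..t} (\<lambda>s. F s (Y g s) - F s (Y h s)))"
      using int that by (simp add: integral_diff)
    also have "\<dots> \<le> integral {0..t} (\<lambda>s. (M * dist g h) * exp (2 * M * s))"
    proof (rule integral_norm_bound_integral)
      fix s assume s: "s \<in> {0..t}"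
      have "norm (F s (Y g s) - F s (Y h s)) \<le> M * norm (Y g s - Y h s)"
        using s lipschitz by simp
      also have "\<dots> = M * (exp (2 * M * s) * dist (apply_bcontfun g s) (apply_bcontfun h s))"
        by (simp add: Y_def dist_norm flip: scaleR_diff_right)
      also have "\<dots> \<le> M * (exp (2 * M * s) * dist g h)"
        using M_pos by (intro mult_left_mono dist_bounded) auto
      finally show "norm (F s (Y g s) - F s (Y h s)) \<le> (M * dist g h) * exp (2 * M * s)"
        by (simp add: algebra_simps)
    qed (rule integrable_diff int exp_integrable that)+
    also have "\<dots> = (M * dist g h) * ((exp (2 * M * t) - 1) / (2 * M))"
      by (rule integral_unique[OF exp_int[OF that]])
    finally have I: "norm (integral {0..t} (\<lambda>s. F s (Y g s)) - integral {0..t} (\<lambda>s. F s (Y h s)))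
        \<le> \<dots>" .
    have "dist (P g t) (P h t) = exp (- (2 * M * t)) *
        norm (integral {0..t} (\<lambda>s. F s (Y g s)) - integral {0..t} (\<lambda>s. F s (Y h s)))"
      by (simp add: P_def dist_norm flip: scaleR_diff_right)
    also have "\<dots> \<le> exp (- (2 * M * t)) * ((M * dist g h) * ((exp (2 * M * t) - 1) / (2 * M)))"
      using I by simp
    also have "\<dots> \<le> (M * dist g h) / (2 * M)"
      using that M_pos by (intro decay) auto
    finally show ?thesis
      using M_pos by simp
  qed
  define Q where "Q g = Bcontfun (\<lambda>t. P g (max 0 t))" for g
  have Q: "apply_bcontfun (Q g) t = P g (max 0 t)" for g t
  proof -
    have "continuous_on UNIV (\<lambda>t. P g (max 0 t))"
      by (rule continuous_on_compose2[OF contP]) (auto intro!: continuous_intros)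
    then have "(\<lambda>t. P g (max 0 t)) \<in> bcontfun"
      by (rule bcontfun_normI) (rule boundP, simp)
    then show ?thesis
      by (simp add: Q_def Bcontfun_inverse)
  qed
  have "\<exists>!g. Q g = g"
  proof (rule banach_fix_type[of "1 / 2"])
    show "\<forall>g h. dist (Q g) (Q h) \<le> 1 / 2 * dist g h"
      by (intro allI dist_bound) (simp only: Q, rule dist_P, simp)
  qed auto
  then obtain g where g: "Q g = g" by blast
  have "Y g T = x + integral {0..T} (\<lambda>s. F s (Y g s))" if "0 \<le> T" for T
  proof -
    have "apply_bcontfun g T = P g T"
      using Q[of g T] that by (simp add: g)
    then show ?thesis
      unfolding Y_def[of g T] by (simp add: P_def exp_minus)
  qed
  then show ?thesis
    using contY by (auto simp: integral_solution_iff)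
qed

end

text \<open>Insert \<open>G s (y s)\<close> between \<open>G s (z s)\<close> and
  \<open>F s (y s)\<close>: the Lipschitz bound of \<open>G\<close> feeds Gronwall, and the
  remaining discrepancy is measured along \<open>y\<close> alone. Taking \<open>F = G\<close> yields
  uniqueness, and keeping \<open>y\<close> fixed while \<open>G\<close> varies yields
  stability.\<close>

lemma integral_solution_dist_le:
  assumes "lipschitz_field F M K" "lipschitz_field G M K'"
    and y: "integral_solution F x y" and z: "integral_solution G x z" and "0 \<le> T"
  shows "norm (z T - y T) \<le> integral {0..T} (\<lambda>s. norm (G s (y s) - F s (y s))) * exp (M * T)"
proof -
  interpret F: lipschitz_field F M K by fact
  interpret G: lipschitz_field G M K' by fact
  have cont: "continuous_on {0..} y" "continuous_on {0..} z"
    using y z by (auto simp: integral_solution_def)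
  have cont_d: "continuous_on {0..t} (\<lambda>t. norm (z t - y t))" for t
    by (intro continuous_intros cont[THEN continuous_on_subset]) auto
  have ae: "(\<lambda>s. norm (G s (y s) - F s (y s))) integrable_on {0..t}" if "0 \<le> t" for t
    using set_integral_diff(1)[OF G.absolutely_integrable_comp[OF cont(1) that]
        F.absolutely_integrable_comp[OF cont(1) that]]
    by (simp add: absolutely_integrable_on_def)
  show ?thesis
  proof (rule gronwall_integral[where d = "\<lambda>t. norm (z t - y t)"])
    fix t assume t: "t \<in> {0..T}"
    have "z t - y t = integral {0..t} (\<lambda>s. G s (z s) - F s (y s))"
      using y z t F.integrable_comp[OF cont(1), of t] G.integrable_comp[OF cont(2), of t]
      by (simp add: integral_solution_def integral_diff)
    also have "norm \<dots> \<le>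
        integral {0..t} (\<lambda>s. norm (G s (y s) - F s (y s)) + M * norm (z s - y s))"
    proof (rule integral_norm_bound_integral)
      fix s assume "s \<in> {0..t}"
      then have "norm (G s (z s) - G s (y s)) \<le> M * norm (z s - y s)"
        by (intro G.lipschitz) auto
      then show "norm (G s (z s) - F s (y s)) \<le>
          norm (G s (y s) - F s (y s)) + M * norm (z s - y s)"
        using norm_triangle_ineq[of "G s (z s) - G s (y s)" "G s (y s) - F s (y s)"] by simp
    next
      show "(\<lambda>s. norm (G s (y s) - F s (y s)) + M * norm (z s - y s)) integrable_on {0..t}"
        using t by (intro integrable_add ae integrable_continuous_real continuous_intros cont_d) auto
    qed (use t F.integrable_comp[OF cont(1), of t] G.integrable_comp[OF cont(2), of t] in
        \<open>auto intro: integrable_diff\<close>)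
    also have "\<dots> = integral {0..t} (\<lambda>s. norm (G s (y s) - F s (y s))) +
        M * integral {0..t} (\<lambda>s. norm (z s - y s))"
      using t by (simp add: integral_add ae integrable_continuous_real cont_d
          integrable_on_mult_right)
    \<comment> \<open>Gronwall's inequality wants a constant that does not depend on
      \<open>t\<close>, hence the enlargement of the interval to \<open>{0..T}\<close>.\<close>
    also have "integral {0..t} (\<lambda>s. norm (G s (y s) - F s (y s))) \<le>
        integral {0..T} (\<lambda>s. norm (G s (y s) - F s (y s)))"
      using t by (intro integral_subset_le ae) auto
    finally show "norm (z t - y t) \<le> integral {0..T} (\<lambda>s. norm (G s (y s) - F s (y s))) +
        M * integral {0..t} (\<lambda>s. norm (z s - y s))"
      by simp
  qed (use \<open>0 \<le> T\<close> F.M_pos cont_d in auto)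
qed

text \<open>Pointwise convergence of the fields is enough, because the discrepancy is evaluated
  along the fixed limit curve \<open>y\<close>. The common constants \<open>M\<close> and
  \<open>K\<close> then give the majorant \<open>2 * (K + M * norm (y s))\<close>, independent of
  \<open>n\<close>.\<close>

lemma integral_solution_tendsto:
  assumes Fn: "\<And>n. lipschitz_field (Fn n) M K" and F: "lipschitz_field F M K"
    and conv: "\<And>s a. 0 \<le> s \<Longrightarrow> (\<lambda>n. Fn n s a) \<longlonglongrightarrow> F s a"
    and yn: "\<And>n. integral_solution (Fn n) x (yn n)" and y: "integral_solution F x y"
    and "0 \<le> T"
  shows "(\<lambda>n. yn n T) \<longlonglongrightarrow> y T"
proof -
  interpret F: lipschitz_field F M K by fact
  interpret Fn: lipschitz_field "Fn n" M K for n by fact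
  have cont: "continuous_on {0..} y"
    using y by (simp add: integral_solution_def)
  have "(\<lambda>n. integral {0..T} (\<lambda>s. norm (Fn n s (y s) - F s (y s)))) \<longlonglongrightarrow>
      integral {0..T} (\<lambda>s. 0)"
  proof (rule dominated_convergence(2)[where h = "\<lambda>s. 2 * (K + M * norm (y s))"])
    show "(\<lambda>s. norm (Fn n s (y s) - F s (y s))) integrable_on {0..T}" for n
      using set_integral_diff(1)[OF Fn.absolutely_integrable_comp[OF cont \<open>0 \<le> T\<close>]
          F.absolutely_integrable_comp[OF cont \<open>0 \<le> T\<close>]]
      by (simp add: absolutely_integrable_on_def)
    show "(\<lambda>s. 2 * (K + M * norm (y s))) integrable_on {0..T}"
      by (intro integrable_continuous_real continuous_intros continuous_on_subset[OF cont]) auto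
    show "norm (norm (Fn n s (y s) - F s (y s))) \<le> 2 * (K + M * norm (y s))"
      if "s \<in> {0..T}" for n s
      using F.growth[of s "y s"] Fn.growth[of s n "y s"]
        norm_triangle_ineq4[of "Fn n s (y s)" "F s (y s)"] that by simp
    show "(\<lambda>n. norm (Fn n s (y s) - F s (y s))) \<longlonglongrightarrow> 0" if "s \<in> {0..T}" for s
      using conv[of s "y s"] that by (simp add: LIM_zero_iff tendsto_norm_zero)
  qed
  then have "(\<lambda>n. integral {0..T} (\<lambda>s. norm (Fn n s (y s) - F s (y s))) * exp (M * T)) \<longlonglongrightarrow> 0"
    by (auto intro: tendsto_mult_left_zero)
  then have "(\<lambda>n. yn n T - y T) \<longlonglongrightarrow> 0"
    by (rule Lim_null_comparison[rotated])
       (auto intro!: always_eventually integral_solution_dist_le[OF F Fn y yn \<open>0 \<le> T\<close>])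
  then show ?thesis
    by (simp add: LIM_zero_iff)
qed

text \<open>This is what gives meaning to the definite description in \<open>state\<close>;
  extensionality removes the freedom at negative times.\<close>

lemma (in lipschitz_field) ex1_integral_solution:
  "\<exists>!y. y \<in> extensional {0..} \<and> integral_solution F x y"
proof -
  obtain y where y: "integral_solution F x y"
    using integral_solution_exists by blast
  then have "integral_solution F x (restrict y {0..})"
    by (subst integral_solution_cong[of _ y F F]) auto
  moreover have "z = z'" if "z \<in> extensional {0..} \<and> integral_solution F x z"
    "z' \<in> extensional {0..} \<and> integral_solution F x z'" for z z'
  proof (rule extensionalityI)
    fix t :: real assume "t \<in> {0..}"
    then show "z t = z' t"
      using integral_solution_dist_le[OF lipschitz_field_axioms lipschitz_field_axioms, of x z' z t]
        that by simp
  qed (use that in auto)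
  ultimately show ?thesis
    by (intro ex1I[of _ "restrict y {0..}"]) auto
qed

section \<open>Grid-constant controls\<close>

text \<open>Comparing with right end points suits the half-open intervals: minimality supplies the
  left inequality. On a temporal grid all negative times get index 0.\<close>

definition grid_index :: "(nat \<Rightarrow> real) \<Rightarrow> real \<Rightarrow> nat" where
  "grid_index \<tau> t = (LEAST k. t < \<tau> (Suc k))"

definition grid_step :: "(nat \<Rightarrow> real) \<Rightarrow> (nat \<Rightarrow> 'a) \<Rightarrow> real \<Rightarrow> 'a" where
  "grid_step \<tau> v t = v (grid_index \<tau> t)"

lemma grid_index_eq:
  assumes "temporal_grid \<tau>" "t \<in> grid_interval \<tau> k"
  shows "grid_index \<tau> t = k"
  unfolding grid_index_def
proof (rule Least_equality)
  show "t < \<tau> (Suc k)"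
    using assms by (simp add: grid_interval_def)
  show "k \<le> j" if "t < \<tau> (Suc j)" for j
    using assms that strict_mono_less[of \<tau> k "Suc j"]
    by (auto simp: grid_interval_def temporal_grid_def)
qed

lemma grid_step_eq:
  "temporal_grid \<tau> \<Longrightarrow> t \<in> grid_interval \<tau> k \<Longrightarrow> grid_step \<tau> v t = v k"
  by (simp add: grid_step_def grid_index_eq)

lemma grid_point_in_interval: "temporal_grid \<tau> \<Longrightarrow> \<tau> k \<in> grid_interval \<tau> k"
  by (simp add: grid_interval_def temporal_grid_def strict_mono_def)

lemma grid_step_grid_point: "temporal_grid \<tau> \<Longrightarrow> grid_step \<tau> v (\<tau> k) = v k"
  by (simp add: grid_step_eq grid_point_in_interval)

lemma grid_point_nonneg: "temporal_grid \<tau> \<Longrightarrow> 0 \<le> \<tau> k"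
  using strict_mono_less_eq[of \<tau> 0 k] by (simp add: temporal_grid_def)

text \<open>Divergence of the grid provides a grid point beyond \<open>t\<close>, so the
  \<open>LEAST\<close> is attained. The left inequality is minimality applied to the predecessor of
  the index, or \<open>\<tau> 0 = 0\<close> if there is none.\<close>

lemma in_grid_interval_grid_index:
  assumes \<tau>: "temporal_grid \<tau>" and "0 \<le> t"
  shows "t \<in> grid_interval \<tau> (grid_index \<tau> t)"
proof -
  have "\<forall>\<^sub>F k in sequentially. t < \<tau> k"
    using \<tau> by (simp add: temporal_grid_def filterlim_at_top_dense)
  then obtain N where "\<forall>k\<ge>N. t < \<tau> k"
    by (auto simp: eventually_sequentially)
  then have ex: "t < \<tau> (Suc N)"
    by simp
  have "\<tau> (grid_index \<tau> t) \<le> t"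
  proof (cases "grid_index \<tau> t")
    case 0
    then show ?thesis
      using assms by (simp add: temporal_grid_def)
  next
    case (Suc j)
    then show ?thesis
      using not_less_Least[of j "\<lambda>k. t < \<tau> (Suc k)"] by (simp add: grid_index_def)
  qed
  moreover have "t < \<tau> (Suc (grid_index \<tau> t))"
    unfolding grid_index_def by (rule LeastI[of "\<lambda>k. t < \<tau> (Suc k)", OF ex])
  ultimately show ?thesis
    by (simp add: grid_interval_def)
qed

lemma in_grid_interval_iff:
  assumes "temporal_grid \<tau>" "0 \<le> t"
  shows "t \<in> grid_interval \<tau> k \<longleftrightarrow> k = grid_index \<tau> t"
  using grid_index_eq in_grid_interval_grid_index assms by blast

text \<open>The step function factors through the measurable index into a discrete space, on which
  every \<open>v\<close> is measurable.\<close>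

lemma measurable_grid_step [measurable]: "grid_step \<tau> v \<in> borel_measurable borel"
  for v :: "nat \<Rightarrow> 'a::topological_space"
proof -
  have "grid_index \<tau> \<in> borel \<rightarrow>\<^sub>M count_space UNIV"
    unfolding grid_index_def by measurable
  then show ?thesis
    unfolding grid_step_def by (rule measurable_compose) simp
qed

text \<open>Each component of \<open>u t\<close> is at most \<open>C\<close> in modulus, so every
  summand of the control term has Lipschitz constant \<open>C * L\<close>. The resulting constants
  depend on \<open>u\<close> only through \<open>C\<close>, hence are common to all controls with
  values in a bounded set.\<close>

lemma lipschitz_field_control_field:
  fixes f0 :: "real^'d \<Rightarrow> real^'d" and f :: "'m::finite \<Rightarrow> real^'d \<Rightarrow> real^'d"
  assumes "0 < L" "0 \<le> C"
    and f0: "\<And>x1 x2. norm (f0 x1 - f0 x2) \<le> L * norm (x1 - x2)"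
    and f: "\<And>i x1 x2. norm (f i x1 - f i x2) \<le> L * norm (x1 - x2)"
    and u: "\<And>t. 0 \<le> t \<Longrightarrow> norm (u t) \<le> C" and [measurable]: "u \<in> borel_measurable borel"
  shows "lipschitz_field (\<lambda>t. control_field f0 f (u t))
    (L + real CARD('m) * (C * L)) (norm (f0 0) + (\<Sum>i\<in>UNIV. C * norm (f i 0)))"
proof
  show "0 < L + real CARD('m) * (C * L)"
    using assms(1,2) by (simp add: add_pos_nonneg)
  have u_le: "\<bar>u t $ i\<bar> \<le> C" if "0 \<le> t" for t i
    using component_le_norm_cart[of "u t" i] u[OF that] by linarith
  show "norm (control_field f0 f (u t) a - control_field f0 f (u t) b) \<le>
      (L + real CARD('m) * (C * L)) * norm (a - b)" if "0 \<le> t" for t a b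
  proof -
    have "control_field f0 f (u t) a - control_field f0 f (u t) b =
        (f0 a - f0 b) + (\<Sum>i\<in>UNIV. (u t $ i) *\<^sub>R (f i a - f i b))"
      by (simp add: control_field_def sum_subtractf scaleR_diff_right)
    also have "norm \<dots> \<le> L * norm (a - b) + (\<Sum>i\<in>(UNIV::'m set). C * (L * norm (a - b)))"
      using u_le[OF that] \<open>0 \<le> C\<close>
      by (intro norm_triangle_mono f0 sum_norm_le) (auto intro!: mult_mono f)
    finally show ?thesis
      by (simp add: algebra_simps)
  qed
  show "norm (control_field f0 f (u t) 0) \<le> norm (f0 0) + (\<Sum>i\<in>UNIV. C * norm (f i 0))"
    if "0 \<le> t" for t
    unfolding control_field_def using u_le[OF that]
    by (intro norm_triangle_mono sum_norm_le) (auto intro!: mult_right_mono)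
  have cont: "continuous_on UNIV f0" "continuous_on UNIV (f i)" for i
    using \<open>0 < L\<close> f0 f
    by (auto intro!: lipschitz_on_continuous_on[of L] lipschitz_onI simp: dist_norm)
  show "(\<lambda>s. control_field f0 f (u s) (y s)) \<in> borel_measurable (lebesgue_on {0..})"
    if y: "continuous_on {0..} y" for y
  proof -
    have u': "u \<in> borel_measurable (lebesgue_on {0..})"
      by (simp add: measurable_completion measurable_restrict_space1)
    have ff: "(\<lambda>s. f0 (y s)) \<in> borel_measurable (lebesgue_on {0..})"
      "(\<lambda>s. f i (y s)) \<in> borel_measurable (lebesgue_on {0..})" for i
      by (intro continuous_imp_measurable_on_sets_lebesgue continuous_on_compose2[OF cont(1) y]
          continuous_on_compose2[OF cont(2) y], auto)+
    have "(\<lambda>s. u s $ i) \<in> borel_measurable (lebesgue_on {0..})" for i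
      by (rule measurable_compose[OF u']) simp
    then show ?thesis
      unfolding control_field_def
      by (intro borel_measurable_add borel_measurable_sum borel_measurable_scaleR ff)
  qed
qed

section \<open>The integral equation against the differential equations on grid intervals\<close>

lemma solves_state_equation_iff:
  "solves_state_equation f0 f x u y \<longleftrightarrow> integral_solution (\<lambda>t. control_field f0 f (u t)) x y"
  by (simp add: solves_state_equation_def integral_solution_def)

lemma state_cong:
  assumes "\<And>t. 0 \<le> t \<Longrightarrow> u t = u' t"
  shows "state f0 f x u = state f0 f x u'"
proof -
  have "solves_state_equation f0 f x u y \<longleftrightarrow> solves_state_equation f0 f x u' y" for y
    unfolding solves_state_equation_iff by (rule integral_solution_cong) (use assms in auto)
  then show ?thesis
    by (simp add: state_def)
qed

lemma integral_solution_state: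
  assumes "lipschitz_field (\<lambda>t. control_field f0 f (u t)) M K"
  shows "integral_solution (\<lambda>t. control_field f0 f (u t)) x (state f0 f x u)"
  using theI'[OF lipschitz_field.ex1_integral_solution[OF assms], of x]
  unfolding state_def solves_state_equation_iff by blast

text \<open>The integrand may jump at grid points, so the fundamental theorem of calculus is applied
  on one interval at a time and the pieces are added by induction.\<close>

lemma solves_grid_equation_imp_integral_solution:
  assumes \<tau>: "temporal_grid \<tau>"
    and F: "lipschitz_field (\<lambda>t. control_field f0 f (grid_step \<tau> v t)) M K"
    and y: "solves_grid_equation \<tau> f0 f x v y"
  shows "integral_solution (\<lambda>t. control_field f0 f (grid_step \<tau> v t)) x y"
proof -
  define g where "g s = control_field f0 f (grid_step \<tau> v s) (y s)" for s
  have cont: "continuous_on {0..} y" and y0: "y 0 = x"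
    using y by (auto simp: solves_grid_equation_def)
  have piece: "(g has_integral y T - y (\<tau> k)) {\<tau> k..T}" if T: "\<tau> k \<le> T" "T \<le> \<tau> (Suc k)" for k T
  \<comment> \<open>The version with interior derivatives is needed: at
    \<open>\<tau> (Suc k)\<close> the integrand \<open>g\<close> has already switched to
    \<open>v (Suc k)\<close>.\<close>
  proof (rule fundamental_theorem_of_calculus_interior[OF T(1)])
    show "continuous_on {\<tau> k..T} y"
      using grid_point_nonneg[OF \<tau>, of k] by (intro continuous_on_subset[OF cont]) auto
    fix s assume s: "s \<in> {\<tau> k<..<T}"
    then have sk: "s \<in> grid_interval \<tau> k"
      using T by (auto simp: grid_interval_def)
    then have "(y has_vector_derivative g s) (at s within grid_interval \<tau> k)"
      using y by (simp add: solves_grid_equation_def g_def grid_step_eq[OF \<tau>])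
    then have "(y has_vector_derivative g s) (at s within {\<tau> k<..<T})"
      by (rule has_vector_derivative_within_subset) (use T in \<open>auto simp: grid_interval_def\<close>)
    then show "(y has_vector_derivative g s) (at s)"
      using has_vector_derivative_within_open[OF s open_greaterThanLessThan] by blast
  qed
  have grid: "(g has_integral y (\<tau> k) - y 0) {0..\<tau> k}" for k
  proof (induction k)
    case 0
    have "\<tau> 0 = 0"
      using \<tau> by (simp add: temporal_grid_def)
    then show ?case
      by (simp add: has_integral_refl)
  next
    case (Suc k)
    have "\<tau> k \<le> \<tau> (Suc k)"
      using grid_point_in_interval[OF \<tau>, of k] by (simp add: grid_interval_def)
    then show ?case
      using has_integral_combine[OF grid_point_nonneg[OF \<tau>] _ Suc piece[OF _ order_refl]]
      by simp
  qed
  have "(g has_integral y T - y 0) {0..T}" if "0 \<le> T" for T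
  proof -
    define k where "k = grid_index \<tau> T"
    have "\<tau> k \<le> T" "T < \<tau> (Suc k)"
      using in_grid_interval_grid_index[OF \<tau> that] by (auto simp: grid_interval_def k_def)
    then show ?thesis
      using has_integral_combine[OF grid_point_nonneg[OF \<tau>] _ grid piece[of k T]] by simp
  qed
  then have "y T = x + integral {0..T} g" if "0 \<le> T" for T
    using integral_unique[of g "y T - y 0" "{0..T}"] that y0 by simp
  then show ?thesis
    using cont by (simp add: lipschitz_field.integral_solution_iff[OF F] g_def[abs_def])
qed

lemma integral_solution_imp_solves_grid_equation:
  assumes \<tau>: "temporal_grid \<tau>"
    and F: "lipschitz_field (\<lambda>t. control_field f0 f (grid_step \<tau> v t)) M K"
    and cont_field: "\<And>u. continuous_on UNIV (control_field f0 f u)"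
    and y: "integral_solution (\<lambda>t. control_field f0 f (grid_step \<tau> v t)) x y"
  shows "solves_grid_equation \<tau> f0 f x v y"
  unfolding solves_grid_equation_def
proof (intro conjI allI ballI)
  define g where "g s = control_field f0 f (grid_step \<tau> v s) (y s)" for s
  show cont: "continuous_on {0..} y"
    using y by (simp add: integral_solution_def)
  have y_eq: "y T = x + integral {0..T} g" if "0 \<le> T" for T
    using y that by (simp add: integral_solution_def g_def[abs_def])
  show "y 0 = x"
    using y_eq[of 0] by simp
  fix k t assume t: "t \<in> grid_interval \<tau> k"
  \<comment> \<open>Freezing the control at \<open>v k\<close> makes the integrand continuous on the
    closed interval, so its indefinite integral can be differentiated; on the half-open interval
    \<open>h\<close> agrees with \<open>g\<close>.\<close>
  define h where "h s = control_field f0 f (v k) (y s)" for s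
  have \<tau>k: "0 \<le> \<tau> k"
    by (rule grid_point_nonneg[OF \<tau>])
  have cont_h: "continuous_on {\<tau> k..\<tau> (Suc k)} h"
    unfolding h_def
    by (rule continuous_on_compose2[OF cont_field continuous_on_subset[OF cont]])
       (use \<tau>k in auto)
  have "((\<lambda>s. y (\<tau> k) + integral {\<tau> k..s} h) has_vector_derivative h t)
      (at t within {\<tau> k..\<tau> (Suc k)})"
    using integral_has_vector_derivative[OF cont_h, of t] t
    by (auto intro!: derivative_eq_intros simp: grid_interval_def)
  then have "((\<lambda>s. y (\<tau> k) + integral {\<tau> k..s} h) has_vector_derivative h t)
      (at t within grid_interval \<tau> k)"
    by (rule has_vector_derivative_within_subset) (auto simp: grid_interval_def)
  moreover have "y s = y (\<tau> k) + integral {\<tau> k..s} h" if s: "s \<in> grid_interval \<tau> k" for s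
  proof -
    have "\<tau> k \<le> s" using s by (simp add: grid_interval_def)
    have "g integrable_on {0..s}"
      unfolding g_def using \<tau>k \<open>\<tau> k \<le> s\<close>
      by (intro lipschitz_field.integrable_comp[OF F] cont) auto
    then have "integral {0..s} g = integral {0..\<tau> k} g + integral {\<tau> k..s} g"
      using Henstock_Kurzweil_Integration.integral_combine[OF \<tau>k \<open>\<tau> k \<le> s\<close>] by metis
    moreover have "integral {\<tau> k..s} g = integral {\<tau> k..s} h"
      by (rule integral_cong)
         (use s in \<open>auto simp: g_def h_def grid_interval_def grid_step_eq[OF \<tau>, of _ k]\<close>)
    ultimately show ?thesis
      using y_eq[of s] y_eq[of "\<tau> k"] \<tau>k \<open>\<tau> k \<le> s\<close> by simp
  qed
  ultimately show "(y has_vector_derivative control_field f0 f (v k) (y t))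
      (at t within grid_interval \<tau> k)"
    unfolding h_def by (rule has_vector_derivative_transform[OF t, rotated])
qed

text \<open>The predicates under the two definite descriptions are equivalent, so the names denote
  the same function and uniqueness for the grid equation needs no separate argument.\<close>

lemma grid_state_eq_state:
  assumes "temporal_grid \<tau>" "lipschitz_field (\<lambda>t. control_field f0 f (grid_step \<tau> v t)) M K"
    and "\<And>u. continuous_on UNIV (control_field f0 f u)"
  shows "grid_state \<tau> f0 f x v = state f0 f x (grid_step \<tau> v)"
proof -
  have "solves_grid_equation \<tau> f0 f x v y \<longleftrightarrow> solves_state_equation f0 f x (grid_step \<tau> v) y" for y
    using solves_grid_equation_imp_integral_solution integral_solution_imp_solves_grid_equation assms
    unfolding solves_state_equation_iff by blast
  then show ?thesis
    by (simp add: grid_state_def state_def)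
qed

section \<open>Existence of minimizers\<close>

text \<open>The direct method, in sequential form because Fatou's lemma concerns sequences. With
  values in \<open>ennreal\<close> an infinite infimum is no special case.\<close>

lemma seq_compact_attains_min:
  fixes h :: "'a::topological_space \<Rightarrow> ennreal"
  assumes "seq_compact S" "S \<noteq> {}"
    and lsc: "\<And>X a. (\<And>n. X n \<in> S) \<Longrightarrow> a \<in> S \<Longrightarrow> X \<longlonglongrightarrow> a \<Longrightarrow> h a \<le> liminf (\<lambda>n. h (X n))"
  shows "\<exists>a\<in>S. \<forall>b\<in>S. h a \<le> h b"
proof -
  obtain H where "\<And>n. H n \<in> h ` S" and H: "H \<longlonglongrightarrow> Inf (h ` S)"
    using Inf_as_limit[of "h ` S"] \<open>S \<noteq> {}\<close> by auto
  then have "\<forall>n. \<exists>a. a \<in> S \<and> H n = h a"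
    by blast
  then obtain X where X: "\<And>n. X n \<in> S" "\<And>n. H n = h (X n)"
    by metis
  obtain a r where a: "a \<in> S" and r: "strict_mono r" "(X \<circ> r) \<longlonglongrightarrow> a"
    using seq_compactE[OF \<open>seq_compact S\<close>, of X] X(1) by blast
  have "h a \<le> liminf (\<lambda>n. h ((X \<circ> r) n))"
    by (rule lsc[OF _ a r(2)]) (use X in auto)
  also have "(\<lambda>n. h ((X \<circ> r) n)) = H \<circ> r"
    using X(2) by auto
  also have "liminf (H \<circ> r) = Inf (h ` S)"
    by (rule lim_imp_Liminf) (use LIMSEQ_subseq_LIMSEQ[OF H r(1)] in auto)
  finally show ?thesis
    using a by (meson INF_lower order_trans)
qed

text \<open>Tychonoff gives compactness; since the index set is countable the product is first
  countable, and compactness becomes sequential.\<close>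

lemma seq_compact_sequences:
  fixes U :: "'a::metric_space set"
  assumes "compact U"
  shows "seq_compact {v :: nat \<Rightarrow> 'a. \<forall>k. v k \<in> U}"
proof -
  have "compactin (product_topology (\<lambda>_::nat. euclidean) UNIV) (PiE UNIV (\<lambda>_. U))"
    using assms by (simp add: compactin_PiE)
  moreover have "PiE UNIV (\<lambda>_. U) = {v :: nat \<Rightarrow> 'a. \<forall>k. v k \<in> U}"
    by auto
  ultimately show ?thesis
    by (simp add: euclidean_product_topology compact_imp_seq_compact)
qed

text \<open>Intervals of positive length are not null sets. This turns the almost-everywhere
  constraint on a control into membership at an actual time.\<close>

lemma AE_positive_imp_ex_interval:
  fixes a b :: real
  assumes "AE t in lebesgue. 0 < t \<longrightarrow> P t" "0 \<le> a" "a < b"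
  shows "\<exists>t\<in>{a<..<b}. P t"
proof (rule ccontr)
  assume no: "\<not> ?thesis"
  from assms(1) have "AE t in lebesgue. t \<notin> {a<..<b}"
    by (rule eventually_mono) (use no assms(2) in auto)
  then have "{a<..<b} \<in> null_sets lebesgue"
    by (subst AE_iff_null_sets) auto
  then show False
    using \<open>a < b\<close> by (auto simp: null_sets_def)
qed

section \<open>The q-th power of the p-norm, the grid weights and the change of variables\<close>

definition power_sum :: "real \<Rightarrow> real \<Rightarrow> real^'m \<Rightarrow> real" where
  "power_sum p q v = (\<Sum>i\<in>UNIV. \<bar>v $ i\<bar> powr p) powr (q / p)"

lemma power_sum_nonneg [simp]: "0 \<le> power_sum p q v"
  by (simp add: power_sum_def)

text \<open>Because the exponents \<open>p\<close> and \<open>q / p\<close> are positive,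
  \<open>powr\<close> stays continuous at base 0, and components of the limit may vanish.\<close>

lemma tendsto_power_sum:
  assumes "0 < p" "0 < q" "v \<longlonglongrightarrow> a"
  shows "(\<lambda>n. power_sum p q (v n)) \<longlonglongrightarrow> power_sum p q a"
  unfolding power_sum_def using assms
  by (intro tendsto_powr' tendsto_sum tendsto_const tendsto_rabs tendsto_vec_nth)
     (auto intro!: always_eventually sum_nonneg)

lemma measurable_power_sum [measurable]: "power_sum p q \<in> borel_measurable borel"
  unfolding power_sum_def by measurable

lemma power_sum_le:
  fixes v :: "real^'m"
  assumes "0 < p" "0 < q" "norm v \<le> C"
  shows "power_sum p q v \<le> (real CARD('m) * C powr p) powr (q / p)"
  unfolding power_sum_def
proof (rule powr_mono2)
  have "\<bar>v $ i\<bar> powr p \<le> C powr p" for i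
    using component_le_norm_cart[of v i] assms by (intro powr_mono2) auto
  then show "(\<Sum>i\<in>UNIV. \<bar>v $ i\<bar> powr p) \<le> real CARD('m) * C powr p"
    using sum_mono[of UNIV "\<lambda>i. \<bar>v $ i\<bar> powr p" "\<lambda>_. C powr p"] by simp
qed (use assms in \<open>auto intro!: sum_nonneg\<close>)

lemma grid_weight_pos:
  assumes "0 < lam" "temporal_grid \<tau>"
  shows "0 < grid_weight lam \<tau> k"
  using assms by (simp add: grid_weight_eq temporal_grid_def strict_mono_def)

text \<open>Up to the factor \<open>1 / lam\<close> the weights are differences of a null sequence,
  so their series telescopes.\<close>

lemma summable_grid_weight:
  assumes "0 < lam" "temporal_grid \<tau>"
  shows "summable (grid_weight lam \<tau>)"
proof -
  have "filterlim (\<lambda>k. lam * \<tau> k) at_top sequentially"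
    using assms by (auto simp: temporal_grid_def intro: filterlim_tendsto_pos_mult_at_top)
  then have "(\<lambda>k. exp (- lam * \<tau> k)) \<longlonglongrightarrow> 0"
    by (auto intro!: filterlim_compose[OF exp_at_bot] simp: filterlim_uminus_at_bot)
  then have "summable (\<lambda>k. exp (- lam * \<tau> k) - exp (- lam * \<tau> (Suc k)))"
    by (rule telescope_summable')
  moreover have "grid_weight lam \<tau> = (\<lambda>k. (exp (- lam * \<tau> k) - exp (- lam * \<tau> (Suc k))) / lam)"
    using assms by (intro ext grid_weight_eq) (auto simp: temporal_grid_def)
  ultimately show ?thesis
    by (simp add: summable_divide)
qed

lemma nn_integral_grid_interval:
  assumes "0 < lam" "temporal_grid \<tau>"
  shows "(\<integral>\<^sup>+t. ennreal (exp (- lam * t)) * indicator (grid_interval \<tau> k) t \<partial>lebesgue) =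
    ennreal (grid_weight lam \<tau> k)"
proof -
  \<comment> \<open>a function that is not integrable would have integral 0\<close>
  have "(\<lambda>t. exp (- lam * t)) integrable_on grid_interval \<tau> k"
    using grid_weight_pos[OF assms, of k] not_integrable_integral
    by (fastforce simp: grid_weight_def)
  then have "((\<lambda>t. exp (- lam * t)) has_integral grid_weight lam \<tau> k) (grid_interval \<tau> k)"
    by (simp add: grid_weight_def has_integral_integrable_integral)
  from nn_integral_has_integral_lebesgue[OF _ this] show ?thesis
    by (simp add: nn_integral_completion ennreal_mult' ennreal_indicator mult.commute)
qed

text \<open>The origin of the exponents in \<Phi>: raising \<open>b powr (- 1 / q)\<close> to the
  power \<open>p\<close> and then \<open>q / p\<close> leaves \<open>inverse b\<close>, which
  cancels the weight, while \<open>1 / p\<close> followed by \<open>p\<close> restores the modulus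
  of the component of \<open>w\<close>.\<close>

lemma grid_weight_power_sum_reparam:
  assumes "0 < p" "0 < q" "0 < lam" "temporal_grid \<tau>"
  shows "grid_weight lam \<tau> k * power_sum p q (reparam p q lam \<tau> w k) =
    (\<Sum>i\<in>UNIV. \<bar>w k $ i\<bar>) powr (q / p)"
proof -
  define b where "b = grid_weight lam \<tau> k"
  have b: "0 < b"
    using assms by (simp add: b_def grid_weight_pos)
  have "\<bar>reparam p q lam \<tau> w k $ i\<bar> powr p = b powr (- p / q) * \<bar>w k $ i\<bar>" for i
    using assms(1,2) b
    by (cases "w k $ i = 0")
       (auto simp: reparam_def b_def[symmetric] abs_mult abs_sgn_eq powr_mult powr_powr)
  then have "power_sum p q (reparam p q lam \<tau> w k) =
      (b powr (- p / q) * (\<Sum>i\<in>UNIV. \<bar>w k $ i\<bar>)) powr (q / p)"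
    by (simp add: power_sum_def sum_distrib_left)
  also have "\<dots> = (b powr (- p / q)) powr (q / p) * (\<Sum>i\<in>UNIV. \<bar>w k $ i\<bar>) powr (q / p)"
    by (intro powr_mult)
  also have "(b powr (- p / q)) powr (q / p) = inverse b"
    using assms(1,2) b by (simp only: powr_powr) (simp add: powr_minus)
  finally show ?thesis
    using b by (simp add: b_def[symmetric] field_simps)
qed

lemma ex_reparam_eq:
  assumes "0 < p" "0 < q" "0 < lam" "temporal_grid \<tau>"
  shows "\<exists>w. reparam p q lam \<tau> w = v"
proof
  define b where "b = grid_weight lam \<tau>"
  have b: "0 < b k" for k
    using assms by (simp add: b_def grid_weight_pos)
  \<comment> \<open>The witness solves
    \<open>b powr (- 1 / q) * r powr (1 / p) = \<bar>v\<bar>\<close> for the modulus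
    \<open>r\<close> and keeps the sign of \<open>v\<close>.\<close>
  show "reparam p q lam \<tau> (\<lambda>k. \<chi> i. b k powr (p / q) * \<bar>v k $ i\<bar> powr p * sgn (v k $ i)) = v"
    (is "reparam p q lam \<tau> ?w = v")
  proof (intro ext vec_eq_iff[THEN iffD2] allI)
    fix k i
    show "reparam p q lam \<tau> ?w k $ i = v k $ i"
    proof (cases "v k $ i = 0")
      case False
      have "\<bar>?w k $ i\<bar> powr (1 / p) = b k powr (1 / q) * \<bar>v k $ i\<bar>"
        using False assms(1,2) b[of k] by (simp add: abs_mult powr_mult powr_powr)
      moreover have "sgn (?w k $ i) = sgn (v k $ i)"
        using False b[of k] by (simp add: sgn_mult)
      moreover have "b k powr (- 1 / q) * b k powr (1 / q) = 1"
        using b[of k] by (simp flip: powr_add)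
      moreover have "reparam p q lam \<tau> ?w k $ i =
          b k powr (- 1 / q) * \<bar>?w k $ i\<bar> powr (1 / p) * sgn (?w k $ i)"
        by (simp add: reparam_def b_def)
      ultimately have "reparam p q lam \<tau> ?w k $ i = 1 * (\<bar>v k $ i\<bar> * sgn (v k $ i))"
        by (metis mult.assoc)
      then show ?thesis
        by (simp add: abs_mult_sgn)
    qed (simp add: reparam_def)
  qed
qed

section \<open>Both problems as minimization over sequences with values in \<open>U\<close>\<close>

locale grid_control_problem =
  fixes f0 :: "real^'d \<Rightarrow> real^'d" and f :: "'m::finite \<Rightarrow> real^'d \<Rightarrow> real^'d"
    and U :: "(real^'m) set" and \<tau> :: "nat \<Rightarrow> real" and L p q lam gam :: real
  assumes L: "0 < L"
    and lipschitz_f0: "\<And>x1 x2. norm (f0 x1 - f0 x2) \<le> L * norm (x1 - x2)"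
    and lipschitz_f: "\<And>i x1 x2. norm (f i x1 - f i x2) \<le> L * norm (x1 - x2)"
    and compact_U: "compact U"
    and grid: "temporal_grid \<tau>"
    and pos: "0 < p" "0 < q" "0 < lam" "0 < gam"
begin

lemma U_bounded: obtains C where "0 \<le> C" "\<And>u. u \<in> U \<Longrightarrow> norm u \<le> C"
  using compact_imp_bounded[OF compact_U] by (metis bounded_pos less_imp_le)

lemma continuous_control_field: "continuous_on UNIV (control_field f0 f u)"
proof -
  have "continuous_on UNIV f0" "continuous_on UNIV (f i)" for i
    using L lipschitz_f0 lipschitz_f
    by (auto intro!: lipschitz_on_continuous_on[of L] lipschitz_onI simp: dist_norm)
  then show ?thesis
    unfolding control_field_def by (intro continuous_intros)
qed

text \<open>The point is the order of quantifiers: \<open>M\<close> and \<open>K\<close> are chosen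
  before the sequence \<open>v\<close>, as stability of the state requires.\<close>

lemma uniformly_lipschitz_field:
  obtains M K where "\<And>v. (\<And>k. v k \<in> U) \<Longrightarrow>
    lipschitz_field (\<lambda>t. control_field f0 f (grid_step \<tau> v t)) M K"
proof -
  obtain C where "0 \<le> C" "\<And>u. u \<in> U \<Longrightarrow> norm u \<le> C"
    using U_bounded by blast
  then have "lipschitz_field (\<lambda>t. control_field f0 f (grid_step \<tau> v t))
      (L + real CARD('m) * (C * L)) (norm (f0 0) + (\<Sum>i\<in>UNIV. C * norm (f i 0)))"
    if "\<And>k. v k \<in> U" for v
    using that L lipschitz_f0 lipschitz_f
    by (intro lipschitz_field_control_field measurable_grid_step) (auto simp: grid_step_def)
  then show ?thesis
    using that by blast
qed

lemma grid_step_in_discrete_controls: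
  assumes "\<And>k. v k \<in> U"
  shows "grid_step \<tau> v \<in> discrete_controls \<tau> U"
proof -
  obtain C where C: "\<And>u. u \<in> U \<Longrightarrow> norm u \<le> C"
    using U_bounded by blast
  have "grid_step \<tau> v t \<in> U" for t
    using assms by (simp add: grid_step_def)
  moreover have "set_borel_measurable lebesgue {0<..} (grid_step \<tau> v)"
    unfolding set_borel_measurable_def by (intro measurable_completion) measurable
  moreover have "grid_step \<tau> v constant_on grid_interval \<tau> k" for k
    using grid_step_eq[OF grid] by (auto simp: constant_on_def)
  ultimately show ?thesis
    using C by (fastforce simp: discrete_controls_def Linf_controls_def)
qed

text \<open>Membership in \<open>U\<close> is given only almost everywhere, but each constant value
  is taken on an interval of positive length, so at some time it is known to lie in
  \<open>U\<close>.\<close>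

lemma discrete_controlsE:
  assumes "u \<in> discrete_controls \<tau> U"
  obtains v where "\<And>k. v k \<in> U" "\<And>t. 0 \<le> t \<Longrightarrow> u t = grid_step \<tau> v t"
proof
  have const: "u t = u (\<tau> k)" if "t \<in> grid_interval \<tau> k" for t k
  proof -
    obtain c where "\<forall>s\<in>grid_interval \<tau> k. u s = c"
      using assms by (auto simp: discrete_controls_def constant_on_def)
    then show ?thesis
      using that grid_point_in_interval[OF grid, of k] by simp
  qed
  show "u (\<tau> k) \<in> U" for k
  proof -
    have "AE t in lebesgue. 0 < t \<longrightarrow> u t \<in> U"
      using assms by (simp add: discrete_controls_def Linf_controls_def)
    then obtain t where "t \<in> {\<tau> k<..<\<tau> (Suc k)}" "u t \<in> U"
      using AE_positive_imp_ex_interval[of "\<lambda>t. u t \<in> U" "\<tau> k" "\<tau> (Suc k)"] grid_point_nonneg[OF grid, of k]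
        grid_point_in_interval[OF grid, of k] by (auto simp: grid_interval_def)
    then show ?thesis
      using const[of t k] by (simp add: grid_interval_def)
  qed
  show "u t = grid_step \<tau> (\<lambda>k. u (\<tau> k)) t" if "0 \<le> t" for t
    using const in_grid_interval_grid_index[OF grid that] by (simp add: grid_step_def)
qed

abbreviation running_cost :: "real^'d \<Rightarrow> real^'d \<Rightarrow> (real \<Rightarrow> real^'m) \<Rightarrow> real \<Rightarrow> real" where
  "running_cost yd x u t \<equiv> exp (- lam * t) *
     (1/2 * (norm (state f0 f x u t - yd))\<^sup>2 + gam * power_sum p q (u t))"

text \<open>At each time exactly one term of the series over grid intervals survives. Agreement for
  nonnegative times suffices, as neither the state nor the cost looks at negative ones.\<close>

lemma discrete_cost_eq:
  assumes u: "\<And>t. 0 \<le> t \<Longrightarrow> u t = grid_step \<tau> v t"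
  shows "discrete_cost p q lam gam yd \<tau> f0 f x u =
    (\<integral>\<^sup>+t\<in>{0..}. ennreal (running_cost yd x (grid_step \<tau> v) t) \<partial>lebesgue)"
proof -
  have "(\<Sum>i\<in>UNIV. \<Sum>k. \<bar>u (\<tau> k) $ i\<bar> powr p * indicator (grid_interval \<tau> k) t) powr (q / p) =
      power_sum p q (grid_step \<tau> v t)" if "0 \<le> t" for t
  proof -
    have "(\<Sum>k. \<bar>u (\<tau> k) $ i\<bar> powr p * indicator (grid_interval \<tau> k) t) =
        (\<Sum>k\<in>{grid_index \<tau> t}. \<bar>u (\<tau> k) $ i\<bar> powr p * indicator (grid_interval \<tau> k) t)" for i
      by (rule suminf_finite) (auto simp: in_grid_interval_iff[OF grid that])
    also have "\<dots> i = \<bar>grid_step \<tau> v t $ i\<bar> powr p" for i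
      using in_grid_interval_grid_index[OF grid that] u grid_point_nonneg[OF grid]
      by (simp add: grid_step_grid_point[OF grid] grid_step_def[of \<tau> v t])
    finally show ?thesis
      by (simp add: power_sum_def)
  qed
  then show ?thesis
    unfolding discrete_cost_def
    using state_cong[OF u, where x = x]
    by (intro nn_integral_cong) (simp split: split_indicator)
qed

lemma continuous_on_state:
  assumes "\<And>k. v k \<in> U"
  shows "continuous_on {0..} (state f0 f x (grid_step \<tau> v))"
  using uniformly_lipschitz_field integral_solution_state assms
  unfolding integral_solution_def by metis

text \<open>Continuity is known only on the half line; \<open>max 0 t\<close> extends the state to a
  continuous, hence Borel, function on the whole line.\<close>

lemma measurable_state:
  assumes "\<And>k. v k \<in> U"
  shows "(\<lambda>t. state f0 f x (grid_step \<tau> v) (max 0 t)) \<in> borel_measurable borel"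
  by (intro borel_measurable_continuous_onI continuous_on_compose2[OF continuous_on_state[OF assms]])
     (auto intro!: continuous_intros)

lemma measurable_running_cost:
  assumes "\<And>k. v k \<in> U"
  shows "(\<lambda>t. ennreal (running_cost yd x (grid_step \<tau> v) t) * indicator {0..} t)
    \<in> borel_measurable lebesgue"
proof -
  note measurable_state[OF assms, measurable]
  have "(\<lambda>t. ennreal (exp (- lam * t) * (1/2 * (norm (state f0 f x (grid_step \<tau> v) (max 0 t) - yd))\<^sup>2
      + gam * power_sum p q (grid_step \<tau> v t))) * indicator {0..} t) \<in> borel_measurable lebesgue"
    by (intro measurable_completion) measurable
  then show ?thesis
    by (rule measurable_cong[THEN iffD1, rotated]) (auto split: split_indicator)
qed

text \<open>All controls in play share one pair \<open>M\<close>, \<open>K\<close>, so the states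
  converge. The integrand then converges at every time, and the \<open>liminf\<close> inside Fatou's
  integral is the integrand of the limit.\<close>

lemma discrete_cost_lsc:
  assumes V: "\<And>n k. V n k \<in> U" and v: "\<And>k. v k \<in> U"
    and lim: "\<And>k. (\<lambda>n. V n k) \<longlonglongrightarrow> v k"
  shows "discrete_cost p q lam gam yd \<tau> f0 f x (grid_step \<tau> v) \<le>
    liminf (\<lambda>n. discrete_cost p q lam gam yd \<tau> f0 f x (grid_step \<tau> (V n)))"
proof -
  obtain M K where MK: "\<And>v. (\<And>k. v k \<in> U) \<Longrightarrow>
      lipschitz_field (\<lambda>t. control_field f0 f (grid_step \<tau> v t)) M K"
    using uniformly_lipschitz_field by blast
  have field: "(\<lambda>n. control_field f0 f (grid_step \<tau> (V n) s) a) \<longlonglongrightarrow>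
      control_field f0 f (grid_step \<tau> v s) a" for s a
    unfolding control_field_def grid_step_def by (intro tendsto_intros lim)
  have state: "(\<lambda>n. state f0 f x (grid_step \<tau> (V n)) t) \<longlonglongrightarrow> state f0 f x (grid_step \<tau> v) t"
    if "0 \<le> t" for t
    by (rule integral_solution_tendsto[OF MK MK field
          integral_solution_state[OF MK] integral_solution_state[OF MK] that])
       (use V v in auto)
  have "(\<lambda>n. power_sum p q (grid_step \<tau> (V n) t)) \<longlonglongrightarrow> power_sum p q (grid_step \<tau> v t)" for t
    unfolding grid_step_def by (intro tendsto_power_sum pos lim)
  then have "(\<lambda>n. ennreal (running_cost yd x (grid_step \<tau> (V n)) t)) \<longlonglongrightarrow>
      ennreal (running_cost yd x (grid_step \<tau> v) t)" if "0 \<le> t" for t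
    by (intro tendsto_ennrealI tendsto_intros state that)
  then have "liminf (\<lambda>n. ennreal (running_cost yd x (grid_step \<tau> (V n)) t) * indicator {0..} t) =
      ennreal (running_cost yd x (grid_step \<tau> v) t) * indicator {0..} t" for t
    by (intro lim_imp_Liminf) (auto split: split_indicator)
  moreover have "(\<integral>\<^sup>+t. liminf (\<lambda>n. ennreal (running_cost yd x (grid_step \<tau> (V n)) t) *
        indicator {0..} t) \<partial>lebesgue) \<le>
      liminf (\<lambda>n. \<integral>\<^sup>+t\<in>{0..}. ennreal (running_cost yd x (grid_step \<tau> (V n)) t) \<partial>lebesgue)"
    by (intro nn_integral_liminf measurable_running_cost V)
  ultimately show ?thesis
    by (simp add: discrete_cost_eq[OF refl])
qed

lemma discrete_cost_attains_min:
  assumes "U \<noteq> {}"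
  obtains v where "\<And>k. v k \<in> U"
    "\<And>v'. (\<And>k. v' k \<in> U) \<Longrightarrow> discrete_cost p q lam gam yd \<tau> f0 f x (grid_step \<tau> v) \<le>
       discrete_cost p q lam gam yd \<tau> f0 f x (grid_step \<tau> v')"
proof -
  have "\<exists>v\<in>{v. \<forall>k. v k \<in> U}. \<forall>v'\<in>{v. \<forall>k. v k \<in> U}.
      discrete_cost p q lam gam yd \<tau> f0 f x (grid_step \<tau> v) \<le>
      discrete_cost p q lam gam yd \<tau> f0 f x (grid_step \<tau> v')"
  proof (rule seq_compact_attains_min[OF seq_compact_sequences[OF compact_U]])
    show "{v :: nat \<Rightarrow> real^'m. \<forall>k. v k \<in> U} \<noteq> {}"
      using assms by auto
    fix V :: "nat \<Rightarrow> nat \<Rightarrow> real^'m" and v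
    assume "\<And>n. V n \<in> {v. \<forall>k. v k \<in> U}" "v \<in> {v. \<forall>k. v k \<in> U}" and lim: "V \<longlonglongrightarrow> v"
    moreover have "(\<lambda>n. V n k) \<longlonglongrightarrow> v k" for k
      by (rule continuous_on_tendsto_compose[OF continuous_on_product_coordinates lim]) auto
    ultimately show "discrete_cost p q lam gam yd \<tau> f0 f x (grid_step \<tau> v) \<le>
        liminf (\<lambda>n. discrete_cost p q lam gam yd \<tau> f0 f x (grid_step \<tau> (V n)))"
      by (intro discrete_cost_lsc) auto
  qed
  then show ?thesis
    using that by auto
qed

lemma reparam_feasible_iff:
  "w \<in> reparam_feasible p q lam \<tau> U \<longleftrightarrow> (\<forall>k. reparam p q lam \<tau> w k \<in> U)"
proof -
  have "w \<in> weight_space p q" if w: "\<And>k. reparam p q lam \<tau> w k \<in> U"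
  proof -
    obtain C where C: "\<And>u. u \<in> U \<Longrightarrow> norm u \<le> C"
      using U_bounded by blast
    define B where "B = (real CARD('m) * C powr p) powr (q / p)"
    have "summable (\<lambda>k. grid_weight lam \<tau> k * power_sum p q (reparam p q lam \<tau> w k))"
    proof (rule summable_comparison_test')
      show "summable (\<lambda>k. grid_weight lam \<tau> k * B)"
        using summable_grid_weight[OF pos(3) grid] by (rule summable_mult2)
      show "norm (grid_weight lam \<tau> k * power_sum p q (reparam p q lam \<tau> w k)) \<le>
          grid_weight lam \<tau> k * B" for k
        using grid_weight_pos[OF pos(3) grid, of k] power_sum_le[OF pos(1,2) C[OF w]]
        by (simp add: B_def abs_mult)
    qed
    then show ?thesis
      by (simp add: weight_space_def grid_weight_power_sum_reparam[OF pos(1,2,3) grid])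
  qed
  then show ?thesis
    by (auto simp: reparam_feasible_def)
qed

lemma reparam_cost_eq:
  assumes "w \<in> reparam_feasible p q lam \<tau> U"
  shows "reparam_cost p q lam gam yd \<tau> f0 f x w =
    discrete_cost p q lam gam yd \<tau> f0 f x (grid_step \<tau> (reparam p q lam \<tau> w))"
proof -
  define v where "v = reparam p q lam \<tau> w"
  have v: "v k \<in> U" for k
    using assms by (simp add: v_def reparam_feasible_iff)
  define y where "y = state f0 f x (grid_step \<tau> v)"
  have grid_state: "grid_state \<tau> f0 f x v = y"
    unfolding y_def using uniformly_lipschitz_field v
    by (metis grid_state_eq_state[OF grid _ continuous_control_field])
  let ?A = "\<lambda>t. ennreal (exp (- lam * t) * (norm (y t - yd))\<^sup>2) * indicator {0..} t"
  let ?B = "\<lambda>k t. ennreal (exp (- lam * t)) * indicator (grid_interval \<tau> k) t"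
  have meas_A: "?A \<in> borel_measurable lebesgue"
  proof -
    note measurable_state[OF v, measurable]
    have "(\<lambda>t. ennreal (exp (- lam * t) * (norm (state f0 f x (grid_step \<tau> v) (max 0 t) - yd))\<^sup>2)
        * indicator {0..} t) \<in> borel_measurable lebesgue"
      by (intro measurable_completion) measurable
    then show ?thesis
      by (rule measurable_cong[THEN iffD1, rotated]) (auto split: split_indicator simp: y_def)
  qed
  have meas_B: "?B k \<in> borel_measurable lebesgue" for k
    unfolding grid_interval_def by (intro measurable_completion) measurable
  \<comment> \<open>Written as a series of nonnegative functions, the control part can be integrated
    term by term, which produces the weights of the grid intervals.\<close>
  have split: "ennreal (running_cost yd x (grid_step \<tau> v) t) * indicator {0..} t =
      ennreal (1/2) * ?A t + (\<Sum>k. ennreal (gam * power_sum p q (v k)) * ?B k t)" for t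
  proof (cases "0 \<le> t")
    case True
    have "(\<Sum>k. ennreal (gam * power_sum p q (v k)) * ?B k t) =
        (\<Sum>k\<in>{grid_index \<tau> t}. ennreal (gam * power_sum p q (v k)) * ?B k t)"
      by (rule suminf_finite) (auto simp: in_grid_interval_iff[OF grid True])
    also have "\<dots> = ennreal (gam * power_sum p q (grid_step \<tau> v t) * exp (- lam * t))"
      using in_grid_interval_grid_index[OF grid True] pos
      by (simp add: grid_step_def ennreal_mult')
    finally have B: "(\<Sum>k. ennreal (gam * power_sum p q (v k)) * ?B k t) = \<dots>" .
    have "running_cost yd x (grid_step \<tau> v) t = 1/2 * (exp (- lam * t) * (norm (y t - yd))\<^sup>2) +
        gam * power_sum p q (grid_step \<tau> v t) * exp (- lam * t)"
      by (simp add: y_def algebra_simps)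
    also have "ennreal \<dots> = ennreal (1/2) * ennreal (exp (- lam * t) * (norm (y t - yd))\<^sup>2) +
        ennreal (gam * power_sum p q (grid_step \<tau> v t) * exp (- lam * t))"
      using pos ennreal_mult'[of "1/2" "exp (- lam * t) * (norm (y t - yd))\<^sup>2"]
      by (subst ennreal_plus) auto
    finally show ?thesis
      unfolding B using True by simp
  next
    case False
    then have "t \<notin> grid_interval \<tau> k" for k
      using grid_point_nonneg[OF grid, of k] by (auto simp: grid_interval_def)
    then show ?thesis
      using False by simp
  qed
  have "discrete_cost p q lam gam yd \<tau> f0 f x (grid_step \<tau> v) =
      ennreal (1/2) * (\<integral>\<^sup>+t. ?A t \<partial>lebesgue) +
      (\<Sum>k. ennreal (gam * power_sum p q (v k)) * ennreal (grid_weight lam \<tau> k))"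
    unfolding discrete_cost_eq[OF refl] split
    using meas_A meas_B nn_integral_grid_interval[OF pos(3) grid]
    by (simp add: nn_integral_add nn_integral_suminf nn_integral_cmult borel_measurable_times
        borel_measurable_suminf)
  also have "(\<Sum>k. ennreal (gam * power_sum p q (v k)) * ennreal (grid_weight lam \<tau> k)) =
      (\<Sum>k. ennreal (gam * (\<Sum>i\<in>UNIV. \<bar>w k $ i\<bar>) powr (q / p)))"
    using pos grid_weight_pos[OF pos(3) grid, THEN less_imp_le]
    by (simp add: v_def mult_ac flip: ennreal_mult'' grid_weight_power_sum_reparam[OF pos(1,2,3) grid])
  \<comment> \<open>Membership in \<open>weight_space\<close> enters here:
    \<open>reparam_cost\<close> uses a real series, whose sum would be an unspecified value if it
    diverged.\<close>
  also have "\<dots> = ennreal (\<Sum>k. gam * (\<Sum>i\<in>UNIV. \<bar>w k $ i\<bar>) powr (q / p))"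
    using assms pos
    by (intro suminf_ennreal2) (auto simp: reparam_feasible_def weight_space_def intro: summable_mult)
  also have "(\<Sum>k. gam * (\<Sum>i\<in>UNIV. \<bar>w k $ i\<bar>) powr (q / p)) =
      gam * (\<Sum>k. (\<Sum>i\<in>UNIV. \<bar>w k $ i\<bar>) powr (q / p))"
    using assms by (intro suminf_mult) (simp add: reparam_feasible_def weight_space_def)
  finally show ?thesis
    by (simp add: reparam_cost_def v_def[symmetric] grid_state)
qed

lemma minimizers_exist:
  assumes "U \<noteq> {}"
  shows "(\<exists>w. is_arg_min (reparam_cost p q lam gam yd \<tau> f0 f x)
                (\<lambda>w. w \<in> reparam_feasible p q lam \<tau> U) w) \<and>
         (\<exists>u. is_arg_min (discrete_cost p q lam gam yd \<tau> f0 f x)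
                (\<lambda>u. u \<in> discrete_controls \<tau> U) u)"
proof -
  obtain v where v: "\<And>k. v k \<in> U"
    and min: "\<And>v'. (\<And>k. v' k \<in> U) \<Longrightarrow> discrete_cost p q lam gam yd \<tau> f0 f x (grid_step \<tau> v) \<le>
       discrete_cost p q lam gam yd \<tau> f0 f x (grid_step \<tau> v')"
    using discrete_cost_attains_min[OF assms] by blast
  obtain w where w: "reparam p q lam \<tau> w = v"
    using ex_reparam_eq[OF pos(1,2,3) grid] by blast
  have "is_arg_min (reparam_cost p q lam gam yd \<tau> f0 f x)
      (\<lambda>w. w \<in> reparam_feasible p q lam \<tau> U) w"
    unfolding is_arg_min_linorder
  proof (intro conjI allI impI)
    show feasible: "w \<in> reparam_feasible p q lam \<tau> U"
      using v by (simp add: reparam_feasible_iff w)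
    fix w' assume "w' \<in> reparam_feasible p q lam \<tau> U"
    then show "reparam_cost p q lam gam yd \<tau> f0 f x w \<le> reparam_cost p q lam gam yd \<tau> f0 f x w'"
      using min[of "reparam p q lam \<tau> w'"]
      by (simp add: reparam_cost_eq feasible w) (simp add: reparam_feasible_iff)
  qed
  moreover have "is_arg_min (discrete_cost p q lam gam yd \<tau> f0 f x)
      (\<lambda>u. u \<in> discrete_controls \<tau> U) (grid_step \<tau> v)"
    unfolding is_arg_min_linorder
  proof (intro conjI allI impI)
    show "grid_step \<tau> v \<in> discrete_controls \<tau> U"
      using v by (rule grid_step_in_discrete_controls)
    fix u assume "u \<in> discrete_controls \<tau> U"
    then obtain v' where "\<And>k. v' k \<in> U" "\<And>t. 0 \<le> t \<Longrightarrow> u t = grid_step \<tau> v' t"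
      using discrete_controlsE by blast
    then show "discrete_cost p q lam gam yd \<tau> f0 f x (grid_step \<tau> v) \<le>
        discrete_cost p q lam gam yd \<tau> f0 f x u"
      using min[of v'] discrete_cost_eq[of u v'] discrete_cost_eq[of "grid_step \<tau> v'" v'] by simp
  qed
  ultimately show ?thesis
    by blast
qed

end

theorem theorem3p3:
  fixes p q lam gam L :: real
    and yd x :: "real^'d"
    and f0 :: "real^'d \<Rightarrow> real^'d"
    and f :: "'m::finite \<Rightarrow> real^'d \<Rightarrow> real^'d"
    and U :: "(real^'m) set"
    and \<tau> :: "nat \<Rightarrow> real"
  assumes "0 < p" "p < 1" "p \<le> q" "q \<le> 1" "0 < lam" "0 < gam"
    and "continuously_differentiable f0"
    and "\<And>i. continuously_differentiable (f i)"
    and "compact U" "convex U"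
    and "0 < L"
    and "\<And>x1 x2. norm (f0 x1 - f0 x2) \<le> L * norm (x1 - x2)"
    and "\<And>i x1 x2. norm (f i x1 - f i x2) \<le> L * norm (x1 - x2)"
    and "\<And>z. \<exists>u\<in>Linf_controls U. cost p q lam gam yd f0 f z u < \<infinity>"
    and "temporal_grid \<tau>"
  shows "(\<exists>w. is_arg_min (reparam_cost p q lam gam yd \<tau> f0 f x)
                (\<lambda>w. w \<in> reparam_feasible p q lam \<tau> U) w) \<and>
         (\<exists>u. is_arg_min (discrete_cost p q lam gam yd \<tau> f0 f x)
                (\<lambda>u. u \<in> discrete_controls \<tau> U) u)"
proof -
  interpret grid_control_problem f0 f U \<tau> L p q lam gam
    by unfold_locales (use assms in auto)
  \<comment> \<open>The finite-cost assumption supplies an admissible control, and its values on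
    \<open>{0<..<1}\<close> show that \<open>U\<close> is nonempty.\<close>
  obtain u where "u \<in> Linf_controls U"
    using assms(14) by blast
  then have "AE t in lebesgue. 0 < t \<longrightarrow> u t \<in> U"
    by (simp add: Linf_controls_def)
  then have "U \<noteq> {}"
    using AE_positive_imp_ex_interval[of "\<lambda>t. u t \<in> U" 0 1] by auto
  then show ?thesis
    by (rule minimizers_exist)
qed

end
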